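(* Let $(\Omega,\mathcal{F},\mathbb{P})$ be a non-atomic complete probability space, let $\rho\in L^0$ satisfy $\mathbb{P}(\rho>0)=1$ and $\mathbb{E}[\rho]<\infty$, and let $X_1\in L^0$, $X_2\in L^1$. Suppose that $\int_0^1|Q_{X_2}(s)|\,ds<\infty$ and $\int_0^1|Q_{X_i}(s)|\,Q_\rho(1-s)\,ds<\infty$ for $i\in\{1,2\}$. Let $Q^*$ be the SSD-minimal quantile function in $\mathscr{Q}_1(Q_{X_1})\cap\mathscr{Q}_2(Q_{X_2})$, which is given by $$Q^*(t)=Q_{X_1}(t)\,\mathbf{1}_{\phi(t)>f(t)}+\big(Q_{X_1}(t)\vee Q_{X_2}(t)\big)\,\mathbf{1}_{\phi(t)=f(t)},\qquad t\in(0,1),$$ where $f(t)=\int_0^t(Q_{X_2}(r)-Q_{X_1}(r))\,dr$ and $\phi(t)=\max_{0\le s\le t}f(s)$ for $t\in[0,1)$. Then $Q^*$ solves the problem of minimizing $$\int_0^1Q(s)Q_\rho(1-s)\,ds$$ over all $Q\in\mathscr{Q}_\rho$ subject to $Q\in\mathscr{Q}_1(Q_{X_1})\cap\mathscr{Q}_2(Q_{X_2})$.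
   Context: $L^0$ is the set of all $\mathcal{F}$-measurable real random variables and $L^1$ the set of integrable ones. For $X\in L^0$ its upper quantile function is $Q_X(t)=\inf\{y\in\mathbb{R}:\mathbb{P}(X\le y)>t\}$, $t\in(0,1)$. $\mathscr{Q}$ is the set of all non-decreasing right-continuous functions $Q:(0,1)\to\mathbb{R}$ (quantile functions). $\mathbf{1}_A$ equals $1$ if the statement $A$ is true and $0$ otherwise; $a\vee b=\max\{a,b\}$; $Q^+=\max\{Q,0\}$. For $Q,Q_0\in\mathscr{Q}$: $Q\succeq_{(1)}Q_0$ means $Q(t)\ge Q_0(t)$ for all $t\in(0,1)$; $Q\succeq_{(2)}Q_0$ means $\int_0^tQ(s)\,ds\ge\int_0^tQ_0(s)\,ds$ for all $t\in(0,1)$. For $i\in\{1,2\}$, $\mathscr{Q}_i(Q_0)=\{Q\in\mathscr{Q}:Q\succeq_{(i)}Q_0\}$. A quantile function $Q^*\in\mathscr{Q}_1(Q_{X_1})\cap\mathscr{Q}_2(Q_{X_2})$ is called SSD-minimal in this set if $Q\in\mathscr{Q}_2(Q^* )$ for every $Q\in\mathscr{Q}_1(Q_{X_1})\cap\mathscr{Q}_2(Q_{X_2})$. $\mathscr{Q}_\rho=\{Q\in\mathscr{Q}:\int_0^1Q^+(s)Q_\rho(1-s)\,ds<\infty\}$. *)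

theory Defs
  imports "HOL-Probability.Probability"
begin

definition non_atomic :: "'a measure \<Rightarrow> bool" where
  "non_atomic M \<longleftrightarrow>
     (\<forall>A\<in>sets M. 0 < emeasure M A \<longrightarrow>
        (\<exists>B\<in>sets M. B \<subseteq> A \<and> 0 < emeasure M B \<and> emeasure M B < emeasure M A))"

(* Functions on (0,1) are total functions on the reals whose values outside (0,1) are
   irrelevant: no definition below looks at them. *)

definition upper_quantile :: "'a measure \<Rightarrow> ('a \<Rightarrow> real) \<Rightarrow> real \<Rightarrow> real" where
  "upper_quantile M X t = Inf {y. measure M {\<omega> \<in> space M. X \<omega> \<le> y} > t}"

definition quantile_functions :: "(real \<Rightarrow> real) set" where
  "quantile_functions =
     {Q. mono_on {0<..<1} Q \<and> (\<forall>t\<in>{0<..<1}. continuous (at_right t) Q)}"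

(* Lebesgue integral with values in the extended reals. Unlike the Bochner integral, which is 0
   for non-integrable functions, it is minus infinity when only the negative part has infinite
   integral. In every use below the integral of the positive part is finite: a non-decreasing
   function is bounded above on (0,t) for t < 1, and membership in quantiles_rho gives
   it for the objective. *)
definition ext_integral :: "real set \<Rightarrow> (real \<Rightarrow> real) \<Rightarrow> ereal" where
  "ext_integral S g =
     enn2ereal (\<integral>\<^sup>+s\<in>S. ennreal (g s) \<partial>lborel) - enn2ereal (\<integral>\<^sup>+s\<in>S. ennreal (- g s) \<partial>lborel)"

definition fsd_ge :: "(real \<Rightarrow> real) \<Rightarrow> (real \<Rightarrow> real) \<Rightarrow> bool" where
  "fsd_ge Q Q0 \<longleftrightarrow> (\<forall>t\<in>{0<..<1}. Q t \<ge> Q0 t)"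

definition ssd_ge :: "(real \<Rightarrow> real) \<Rightarrow> (real \<Rightarrow> real) \<Rightarrow> bool" where
  "ssd_ge Q Q0 \<longleftrightarrow> (\<forall>t\<in>{0<..<1}. ext_integral {0<..<t} Q \<ge> ext_integral {0<..<t} Q0)"

definition fsd_set :: "(real \<Rightarrow> real) \<Rightarrow> (real \<Rightarrow> real) set" where
  "fsd_set Q0 = {Q \<in> quantile_functions. fsd_ge Q Q0}"

definition ssd_set :: "(real \<Rightarrow> real) \<Rightarrow> (real \<Rightarrow> real) set" where
  "ssd_set Q0 = {Q \<in> quantile_functions. ssd_ge Q Q0}"

definition ssd_minimal :: "(real \<Rightarrow> real) set \<Rightarrow> (real \<Rightarrow> real) \<Rightarrow> bool" where
  "ssd_minimal C Qs \<longleftrightarrow> Qs \<in> C \<and> (\<forall>Q\<in>C. Q \<in> ssd_set Qs)"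

definition quantiles_rho :: "(real \<Rightarrow> real) \<Rightarrow> (real \<Rightarrow> real) set" where
  "quantiles_rho Qrho =
     {Q \<in> quantile_functions. (\<integral>\<^sup>+s\<in>{0<..<1}. ennreal (max (Q s) 0 * Qrho (1 - s)) \<partial>lborel) < \<infinity>}"

definition gap :: "(real \<Rightarrow> real) \<Rightarrow> (real \<Rightarrow> real) \<Rightarrow> real \<Rightarrow> real" where
  "gap Q1 Q2 t = (LINT r:{0<..<t}|lborel. Q2 r - Q1 r)"

(* When Q1 and Q2 are integrable on (0,t), the gap is continuous on [0,t], so this supremum is the maximum.
   The library's Max is only meaningful for finite sets. *)
definition max_gap :: "(real \<Rightarrow> real) \<Rightarrow> (real \<Rightarrow> real) \<Rightarrow> real \<Rightarrow> real" where
  "max_gap Q1 Q2 t = (SUP s\<in>{0..t}. gap Q1 Q2 s)"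

definition cost :: "(real \<Rightarrow> real) \<Rightarrow> (real \<Rightarrow> real) \<Rightarrow> ereal" where
  "cost Qrho Q = ext_integral {0<..<1} (\<lambda>s. Q s * Qrho (1 - s))"

end

(* Write g = Q2 - Q1, so that f is the integral of g, and let h = Qs - Q1, that is, the positive
   part of g on {phi = f} and 0 elsewhere. At every point h is the right derivative of phi, hence
   phi(t) is the integral of h over (0,t), and the integral of Qs over (0,t) is that of Q1 plus
   phi(t). Any feasible Q dominates Q2 in integral up to s and Q1 pointwise after s, so its integral
   up to t is at least that of Q1 plus f(s) for every s <= t, hence at least that of Qs. As the
   weight Qrho(1 - s) is non-increasing in s, its superlevel sets are initial segments of (0,1), and
   the layer cake formula turns this domination into domination of the weighted integrals. *)

theory Submission imports Defs begin

subsection \<open>Upper quantile functions\<close>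

text \<open>As \<open>X1\<close> is only measurable, \<open>Q1\<close> need not be integrable near
  1, so unweighted integrals are taken over (0,t) with t < 1 only; that \<open>Q1\<close> is
  integrable there comes from its weighted integrability and the positivity of the weight. The
  obstacle in identifying \<open>\<phi>\<close> with the integral of \<open>h\<close> is that
  \<open>g\<close> may jump and change sign infinitely often, so \<open>\<phi>\<close> need not have
  a two-sided derivative; a continuous function with zero right derivative is still constant, and
  this is applied to the difference of the two sides. Weighted integrals are compared through the
  excess over \<open>Q1\<close>, which is non-negative for every feasible function, so that the
  layer cake formula needs no care about signs. The bound by \<open>Q1\<close> from below also makes
  every cost that is compared finite.\<close>

context prob_space
begin

text \<open>\<open>Inf\<close> on the reals is informative only for non-empty sets that are bounded
  below. The limits of the distribution function at plus and minus infinity provide both properties,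
  here and in the next lemma.\<close>

lemma upper_quantile_set_nonempty:
  fixes X :: "'a \<Rightarrow> real"
  assumes X: "random_variable borel X" and "t < 1"
  shows "{y. measure M {\<omega> \<in> space M. X \<omega> \<le> y} > t} \<noteq> {}"
proof -
  interpret D: real_distribution "distr M borel X"
    using X by (rule real_distribution_distr)
  have "\<forall>\<^sub>F y in at_top. t < cdf (distr M borel X) y"
    using D.cdf_lim_at_top_prob \<open>t < 1\<close> by (rule order_tendstoD)
  then obtain y where "t < cdf (distr M borel X) y"
    by (auto simp: eventually_at_top_linorder)
  then have "t < measure M {\<omega> \<in> space M. X \<omega> \<le> y}"
    using X by (simp add: cdf_def measure_distr vimage_def Int_def conj_commute)
  then show ?thesis by blast
qed

lemma upper_quantile_set_bdd_below:
  fixes X :: "'a \<Rightarrow> real"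
  assumes X: "random_variable borel X" and "0 < t"
  shows "bdd_below {y. measure M {\<omega> \<in> space M. X \<omega> \<le> y} > t}"
proof -
  interpret D: real_distribution "distr M borel X"
    using X by (rule real_distribution_distr)
  have "\<forall>\<^sub>F y in at_bot. cdf (distr M borel X) y < t"
    using D.cdf_lim_at_bot \<open>0 < t\<close> by (rule order_tendstoD)
  then obtain l where "cdf (distr M borel X) l < t"
    by (auto simp: eventually_at_bot_linorder)
  then have l: "measure M {\<omega> \<in> space M. X \<omega> \<le> l} < t"
    using X by (simp add: cdf_def measure_distr vimage_def Int_def conj_commute)
  show ?thesis
  proof (rule bdd_belowI[of _ l])
    fix y assume y: "y \<in> {y. measure M {\<omega> \<in> space M. X \<omega> \<le> y} > t}"
    show "l \<le> y"
    proof (rule ccontr)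
      assume "\<not> l \<le> y"
      then have "measure M {\<omega> \<in> space M. X \<omega> \<le> y} \<le> measure M {\<omega> \<in> space M. X \<omega> \<le> l}"
        using X by (intro finite_measure_mono) auto
      with y l show False by simp
    qed
  qed
qed

text \<open>Monotonicity holds because the sets under \<open>Inf\<close> shrink as t grows.
  Right-continuity rests on the strict inequality in the definition: a level y whose probability
  exceeds t still works for all x slightly above t.\<close>

lemma upper_quantile_in_quantile_functions:
  fixes X :: "'a \<Rightarrow> real"
  assumes X: "random_variable borel X"
  shows "upper_quantile M X \<in> quantile_functions"
proof -
  note ne = upper_quantile_set_nonempty[OF X] and bd = upper_quantile_set_bdd_below[OF X]
  have mono: "upper_quantile M X s \<le> upper_quantile M X t" if "0 < s" "s \<le> t" "t < 1" for s t
    unfolding upper_quantile_def using that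
    by (intro cInf_superset_mono ne bd) auto
  have cont: "continuous (at_right t) (upper_quantile M X)" if t: "0 < t" "t < 1" for t
    unfolding continuous_within
  proof (rule order_tendstoI)
    fix a assume "a < upper_quantile M X t"
    then show "\<forall>\<^sub>F x in at_right t. a < upper_quantile M X x"
      unfolding eventually_at_right[OF t(2)]
      using mono t by (intro exI[of _ 1]) (auto intro: order.strict_trans2)
  next
    fix a assume "upper_quantile M X t < a"
    then obtain y where y: "measure M {\<omega> \<in> space M. X \<omega> \<le> y} > t" "y < a"
      unfolding upper_quantile_def using ne[OF t(2)] bd[OF t(1)] by (subst (asm) cInf_less_iff) auto
    show "\<forall>\<^sub>F x in at_right t. upper_quantile M X x < a"
      unfolding eventually_at_right[OF y(1)]
    proof (intro exI[of _ "measure M {\<omega> \<in> space M. X \<omega> \<le> y}"] conjI y(1) allI impI)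
      fix x assume x: "t < x" "x < measure M {\<omega> \<in> space M. X \<omega> \<le> y}"
      then have "upper_quantile M X x \<le> y"
        unfolding upper_quantile_def using t by (intro cInf_lower bd) auto
      then show "upper_quantile M X x < a" using y by simp
    qed
  qed
  show ?thesis
    unfolding quantile_functions_def using mono cont by (auto intro!: mono_onI)
qed

text \<open>The distribution function vanishes at 0 and is right-continuous there, so it stays below
  t on some (0,b), and no level under b/2 can qualify. Strict positivity matters later, where the
  weight is a divisor.\<close>

lemma upper_quantile_pos:
  fixes X :: "'a \<Rightarrow> real"
  assumes X: "random_variable borel X" and pos: "measure M {\<omega> \<in> space M. X \<omega> > 0} = 1"
    and t: "0 < t" "t < 1"
  shows "0 < upper_quantile M X t"
proof -
  interpret D: real_distribution "distr M borel X"
    using X by (rule real_distribution_distr)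
  have F: "cdf (distr M borel X) y = measure M {\<omega> \<in> space M. X \<omega> \<le> y}" for y
    using X by (simp add: cdf_def measure_distr vimage_def Int_def conj_commute)
  have "measure M {\<omega> \<in> space M. X \<omega> \<le> 0} = measure M (space M - {\<omega> \<in> space M. X \<omega> > 0})"
    by (intro arg_cong[where f = "measure M"]) auto
  also have "\<dots> = 0"
    using X pos by (subst prob_compl) auto
  finally have "cdf (distr M borel X) 0 < t" using t F by simp
  moreover have "(cdf (distr M borel X) \<longlongrightarrow> cdf (distr M borel X) 0) (at_right 0)"
    using D.cdf_is_right_cont[of 0] by (simp add: continuous_within)
  ultimately have "\<forall>\<^sub>F y in at_right 0. cdf (distr M borel X) y < t"
    by (auto dest: order_tendstoD)
  then obtain b where b: "0 < b" "\<And>y. 0 < y \<Longrightarrow> y < b \<Longrightarrow> cdf (distr M borel X) y < t"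
    by (auto simp: eventually_at_right[of 0 1])
  have "b / 2 \<le> y" if "t < measure M {\<omega> \<in> space M. X \<omega> \<le> y}" for y
  proof (rule ccontr)
    assume "\<not> b / 2 \<le> y"
    then have "cdf (distr M borel X) y \<le> cdf (distr M borel X) (b / 2)"
      by (intro D.cdf_nondecreasing) simp
    moreover have "cdf (distr M borel X) (b / 2) < t" using b by simp
    ultimately show False using that F by simp
  qed
  then have "b / 2 \<le> upper_quantile M X t"
    unfolding upper_quantile_def using upper_quantile_set_nonempty[OF X t(2)]
    by (intro cInf_greatest) auto
  with b show ?thesis by simp
qed

end

text \<open>Both parts are finite, so the extended subtraction is an ordinary one. This is the
  passage from the extended-valued definitions to real integrals.\<close>

lemma ext_integral_eq_integral:
  assumes "set_integrable lborel S g"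
  shows "ext_integral S g = ereal (LINT s:S|lborel. g s)"
proof -
  let ?g = "\<lambda>s. indicator S s * g s"
  have int: "integrable lborel ?g" using assms by (simp add: set_integrable_def)
  have 1: "(\<integral>\<^sup>+s\<in>S. ennreal (g s) \<partial>lborel) = (\<integral>\<^sup>+s. ennreal (?g s) \<partial>lborel)"
    and 2: "(\<integral>\<^sup>+s\<in>S. ennreal (- g s) \<partial>lborel) = (\<integral>\<^sup>+s. ennreal (- ?g s) \<partial>lborel)"
    by (auto intro!: nn_integral_cong simp: indicator_def)
  obtain r q where "0 \<le> r" "0 \<le> q"
    "(\<integral>\<^sup>+s. ennreal (?g s) \<partial>lborel) = ennreal r" "(\<integral>\<^sup>+s. ennreal (- ?g s) \<partial>lborel) = ennreal q"
    "integral\<^sup>L lborel ?g = r - q"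
    using int by (rule integrableE)
  then show ?thesis
    unfolding ext_integral_def 1 2 set_lebesgue_integral_def by simp
qed

section \<open>Regularity and integrals of quantile functions\<close>

lemma quantile_functions_mono_on: "Q \<in> quantile_functions \<Longrightarrow> mono_on {0<..<1} Q"
  by (simp add: quantile_functions_def)

lemma quantile_functions_mono:
  "Q \<in> quantile_functions \<Longrightarrow> 0 < s \<Longrightarrow> s \<le> t \<Longrightarrow> t < 1 \<Longrightarrow> Q s \<le> Q t"
  unfolding quantile_functions_def by (auto intro: mono_onD[of "{0<..<1}" Q])

lemma quantile_functions_right_tendsto:
  "Q \<in> quantile_functions \<Longrightarrow> 0 < t \<Longrightarrow> t < 1 \<Longrightarrow> (Q \<longlongrightarrow> Q t) (at_right t)"
  unfolding quantile_functions_def by (auto simp: continuous_within)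

lemma mono_on_set_borel_measurable:
  fixes Q :: "real \<Rightarrow> real"
  assumes "mono_on {0<..<1} Q" "S \<in> sets borel" "S \<subseteq> {0<..<1}"
  shows "set_borel_measurable borel S Q"
proof -
  have "mono_on S Q"
    using assms by (auto intro: mono_on_subset)
  then have "Q \<in> borel_measurable (restrict_space borel S)"
    by (rule borel_measurable_mono_on_fnc)
  then show ?thesis
    using assms by (simp add: set_borel_measurable_def borel_measurable_restrict_space_iff)
qed

text \<open>Since t < 1, monotonicity bounds \<open>Q\<close> on (0,t) by the number
  \<open>Q t\<close>, so an integrable lower bound suffices. It is applied to \<open>Qs\<close> and
  to all feasible functions, with \<open>Q1\<close> as the lower bound.\<close>

lemma mono_on_set_integrable_above:
  fixes Q :: "real \<Rightarrow> real"
  assumes Q: "mono_on {0<..<1} Q" and "t < 1"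
    and Q0: "set_integrable lborel {0<..<t} Q0" and le: "\<And>s. s \<in> {0<..<t} \<Longrightarrow> Q0 s \<le> Q s"
  shows "set_integrable lborel {0<..<t} Q"
proof (rule set_integrable_bound)
  show "set_integrable lborel {0<..<t} (\<lambda>s. \<bar>Q0 s\<bar> + \<bar>Q t\<bar>)"
  proof (intro set_integral_add set_integrable_abs Q0)
    have "emeasure lborel {0<..<t} < \<infinity>" by (cases "0 \<le> t") auto
    then show "set_integrable lborel {0<..<t} (\<lambda>_. Q t)"
      unfolding set_integrable_def by (intro integrable_scaleR_left integrable_real_indicator) auto
  qed
  show "set_borel_measurable lborel {0<..<t} Q"
    using mono_on_set_borel_measurable[OF Q, of "{0<..<t}"] \<open>t < 1\<close>
    by (simp add: set_borel_measurable_def subset_eq)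
  have "\<bar>Q s\<bar> \<le> \<bar>Q0 s\<bar> + \<bar>Q t\<bar>" if "s \<in> {0<..<t}" for s
    using le[OF that] mono_onD[OF Q, of s t] that \<open>t < 1\<close> by auto
  then show "AE s in lborel. s \<in> {0<..<t} \<longrightarrow> norm (Q s) \<le> norm (\<bar>Q0 s\<bar> + \<bar>Q t\<bar>)"
    by auto
qed

text \<open>Moves to the gauge integral on the closed interval, which comes with splitting of
  intervals and continuity of the indefinite integral.\<close>

lemma set_integrable_Ioo_integral:
  fixes g :: "real \<Rightarrow> real"
  assumes "set_integrable lborel {a<..<b} g"
  shows "g integrable_on {a..b}" "(LINT s:{a<..<b}|lborel. g s) = integral {a..b} g"
  using set_borel_integral_eq_integral[OF assms]
  by (simp_all add: integrable_on_open_interval_real integral_open_interval_real)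

text \<open>By right-continuity a strict inequality at t persists, with a margin, on some interval
  [t,u], whose two integrals would then differ.\<close>

lemma quantile_functions_eq_if_integrals_eq:
  assumes Q: "Q \<in> quantile_functions" "Q' \<in> quantile_functions"
    and int: "\<And>t. t \<in> {0<..<1} \<Longrightarrow> Q integrable_on {0..t}" "\<And>t. t \<in> {0<..<1} \<Longrightarrow> Q' integrable_on {0..t}"
    and eq: "\<And>t. t \<in> {0<..<1} \<Longrightarrow> integral {0..t} Q = integral {0..t} Q'"
    and t: "t \<in> {0<..<1}"
  shows "Q t = Q' t"
proof -
  \<comment> \<open>Proved for an arbitrary pair, so that it can be used again with the roles
    exchanged.\<close>
  have "\<not> Q t < Q' t"
    if Q: "Q \<in> quantile_functions" "Q' \<in> quantile_functions"
    and int: "\<And>t. t \<in> {0<..<1} \<Longrightarrow> Q integrable_on {0..t}" "\<And>t. t \<in> {0<..<1} \<Longrightarrow> Q' integrable_on {0..t}"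
    and eq: "\<And>t. t \<in> {0<..<1} \<Longrightarrow> integral {0..t} Q = integral {0..t} Q'" for Q Q'
  proof
    assume less: "Q t < Q' t"
    define e where "e = (Q' t - Q t) / 2"
    have "e > 0" using less by (simp add: e_def)
    have "((\<lambda>s. Q' s - Q s) \<longlongrightarrow> Q' t - Q t) (at_right t)"
      using Q t by (intro tendsto_diff quantile_functions_right_tendsto) auto
    moreover have "e < Q' t - Q t" using less by (simp add: e_def field_simps)
    ultimately have "\<forall>\<^sub>F s in at_right t. e < Q' s - Q s" by (rule order_tendstoD)
    then obtain b where b: "b > t" "\<And>s. t < s \<Longrightarrow> s < b \<Longrightarrow> e < Q' s - Q s"
      using t by (auto simp: eventually_at_right[of t 1])
    define u where "u = (t + min b 1) / 2"
    have u: "t < u" "u < b" "u < 1" using b t by (auto simp: u_def min_def)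
    have sub: "Q integrable_on {t..u}" "Q' integrable_on {t..u}"
      using int[of u] t u by (auto elim!: integrable_on_subinterval)
    have comb: "integral {0..u} F = integral {0..t} F + integral {t..u} F"
      if "F integrable_on {0..u}" for F :: "real \<Rightarrow> real"
      using that t u by (intro Henstock_Kurzweil_Integration.integral_combine[symmetric]) auto
    have "e * (u - t) = integral {t..u} (\<lambda>_. e)" using u by simp
    also have "\<dots> \<le> integral {t..u} (\<lambda>s. Q' s - Q s)"
    proof (rule integral_le)
      fix s assume "s \<in> {t..u}"
      then show "e \<le> Q' s - Q s" using b u less \<open>e < Q' t - Q t\<close> by (cases "s = t") (auto intro!: less_imp_le)
    qed (use sub in \<open>auto intro: integrable_diff\<close>)
    also have "\<dots> = integral {t..u} Q' - integral {t..u} Q"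
      using sub by (simp add: Henstock_Kurzweil_Integration.integral_diff)
    also have "\<dots> = 0"
      using comb[of Q] comb[of Q'] int[of u] eq[of u] eq[of t] t u by simp
    finally show False using \<open>e > 0\<close> u by (simp add: mult_le_0_iff)
  qed
  from this[OF Q int eq] this[OF Q(2,1) int(2,1) eq[symmetric]] show ?thesis by simp
qed

subsection \<open>Right derivatives and monotone weights\<close>

text \<open>The assumption says that the right derivative of \<open>D\<close> vanishes inside the
  interval. For each e > 0 the bound with slope e extends to a last point, by continuity, and from
  any point before \<open>b\<close> the right derivative carries it further.\<close>

lemma right_derivative_zero_imp_eq:
  fixes D :: "real \<Rightarrow> real"
  assumes "a < b" and cont: "continuous_on {a..b} D"
    and deriv: "\<And>t e. a < t \<Longrightarrow> t < b \<Longrightarrow> 0 < e \<Longrightarrow> \<forall>\<^sub>F u in at_right t. \<bar>D u - D t\<bar> \<le> e * (u - t)"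
  shows "D b = D a"
proof -
  \<comment> \<open>The start c lies strictly right of \<open>a\<close>, where \<open>deriv\<close>
    gives no information; \<open>a\<close> itself is reached at the end by continuity.\<close>
  have bound: "\<bar>D b - D c\<bar> \<le> e * (b - c)" if c: "a < c" "c < b" and "e > 0" for c e
  proof -
    define K where "K = {t \<in> {c..b}. \<bar>D t - D c\<bar> \<le> e * (t - c)}"
    have "continuous_on {c..b} D" using cont c by (auto intro: continuous_on_subset)
    then have "closed K" unfolding K_def
      by (intro continuous_on_closed_Collect_le continuous_intros) auto
    moreover have "K \<subseteq> {c..b}" by (auto simp: K_def)
    ultimately have "compact K" using compact_Icc closed_Int_compact by (metis Int_absorb2)
    moreover have "c \<in> K" using c by (simp add: K_def)
    ultimately obtain m where m: "m \<in> K" "\<And>t. t \<in> K \<Longrightarrow> t \<le> m"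
      using compact_attains_sup[of K] by auto
    have "m = b"
    proof (rule ccontr)
      assume "m \<noteq> b"
      then have mb: "c \<le> m" "m < b" using m by (auto simp: K_def)
      then have "\<forall>\<^sub>F u in at_right m. \<bar>D u - D m\<bar> \<le> e * (u - m)"
        using c \<open>e > 0\<close> by (intro deriv) auto
      then have "\<forall>\<^sub>F u in at_right m. \<bar>D u - D m\<bar> \<le> e * (u - m) \<and> m < u \<and> u < b"
        using eventually_at_right_real[OF mb(2)] by eventually_elim auto
      then obtain u where u: "\<bar>D u - D m\<bar> \<le> e * (u - m)" "m < u" "u < b"
        using eventually_happens[of _ "at_right m"] by auto
      moreover have "\<bar>D m - D c\<bar> \<le> e * (m - c)" using m by (simp add: K_def)
      ultimately have "u \<in> K" using mb by (auto simp: K_def algebra_simps abs_le_iff)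
      then show False using m u by fastforce
    qed
    then show ?thesis using m by (simp add: K_def)
  qed
  have eq: "D c = D b" if c: "a < c" "c < b" for c
  proof (rule ccontr)
    assume "D c \<noteq> D b"
    \<comment> \<open>This slope bounds the distance of \<open>D b\<close> and \<open>D c\<close> by
      half of itself.\<close>
    then show False using bound[OF c, of "\<bar>D b - D c\<bar> / (2 * (b - c))"] c
      by (simp add: field_simps)
  qed
  have "(D \<longlongrightarrow> D a) (at_right a)"
    using cont \<open>a < b\<close> by (simp add: continuous_on_Icc_at_rightD)
  moreover have "(D \<longlongrightarrow> D b) (at_right a)"
    using eventually_at_right_real[OF \<open>a < b\<close>] by (intro tendsto_eventually) (auto elim!: eventually_mono dest: eq)
  ultimately show ?thesis by (metis tendsto_unique trivial_limit_at_right_real)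
qed

text \<open>With values in \<open>ennreal\<close> no integrability is required, and Tonelli's
  theorem allows the exchange of integrals in \<open>layer\<close>.\<close>

lemma nn_integral_mult_antimono_on_le:
  fixes A B :: "real \<Rightarrow> ennreal" and w :: "real \<Rightarrow> real"
  assumes [measurable]: "A \<in> borel_measurable borel" "B \<in> borel_measurable borel"
    and w: "antimono_on {0<..<1} w"
    and le: "\<And>t. t \<in> {0<..<1} \<Longrightarrow> (\<integral>\<^sup>+s\<in>{0<..<t}. B s \<partial>lborel) \<le> (\<integral>\<^sup>+s\<in>{0<..<t}. A s \<partial>lborel)"
  shows "(\<integral>\<^sup>+s\<in>{0<..<1}. B s * ennreal (w s) \<partial>lborel) \<le> (\<integral>\<^sup>+s\<in>{0<..<1}. A s * ennreal (w s) \<partial>lborel)"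
proof -
  define W where "W = (\<lambda>s. indicator {0<..<1} s * w s)"
  have "mono_on {0<..<1} (\<lambda>s. - w s)" using w by (auto simp: monotone_on_def)
  then have "(\<lambda>s. - (indicator {0<..<1} s *\<^sub>R - w s)) \<in> borel_measurable borel"
    using mono_on_set_borel_measurable[of "\<lambda>s. - w s" "{0<..<1}"]
    by (intro borel_measurable_uminus) (auto simp: set_borel_measurable_def)
  then have [measurable]: "W \<in> borel_measurable borel" by (simp add: W_def)
  \<comment> \<open>The superlevel set of the weight. As \<open>W\<close> is 0 outside (0,1), it
    lies in (0,1) for y at least 0; it is made empty for negative y, which the layer cake formula
    must ignore.\<close>
  define J where "J = (\<lambda>y. {s. 0 \<le> y \<and> y < W s})"
  have [measurable]: "J y \<in> sets borel" for y unfolding J_def by measurable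

  \<comment> \<open>A superlevel set may fill (0,1), a case outside the range of \<open>le\<close>;
    it follows by monotone convergence.\<close>
  have full: "(\<integral>\<^sup>+s\<in>{0<..<1}. B s \<partial>lborel) \<le> (\<integral>\<^sup>+s\<in>{0<..<1}. A s \<partial>lborel)"
  proof -
    \<comment> \<open>The summand 2 keeps the right end strictly between 0 and 1 already for n =
      0.\<close>
    let ?X = "\<lambda>n::nat. {0<..<1 - 1 / (real n + 2)}"
    have sup: "(\<integral>\<^sup>+s\<in>{0<..<1}. F s \<partial>lborel) = (SUP n. \<integral>\<^sup>+s\<in>?X n. F s \<partial>lborel)"
      if [measurable]: "F \<in> borel_measurable borel" for F :: "real \<Rightarrow> ennreal"
    proof -
      have un: "(\<Union>n. ?X n) = {0<..<1}"
      proof (intro equalityI subsetI)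
        fix s :: real assume s: "s \<in> {0<..<1}"
        then obtain n where "n \<noteq> 0" "inverse (real n) < 1 - s" using real_arch_inverse[of "1 - s"] by auto
        moreover have "1 / (real n + 2) \<le> inverse (real n)" using \<open>n \<noteq> 0\<close> by (simp add: field_simps)
        ultimately show "s \<in> (\<Union>n. ?X n)" using s by (auto intro!: exI[of _ n])
      next
        fix s assume "s \<in> (\<Union>n. ?X n)"
        then obtain n where "0 < s" "s < 1 - 1 / (real n + 2)" by auto
        moreover have "0 < 1 / (real n + 2)" by simp
        ultimately show "s \<in> {0<..<1}" by (intro greaterThanLessThan_iff[THEN iffD2] conjI; linarith)
      qed
      have "incseq ?X"
      proof (rule monoI)
        fix m n :: nat assume "m \<le> n"
        then have "1 - 1 / (real m + 2) \<le> 1 - 1 / (real n + 2)" by (simp add: frac_le)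
        then show "?X m \<subseteq> ?X n" by auto
      qed
      then have "(SUP n. emeasure (density lborel F) (?X n)) = emeasure (density lborel F) (\<Union>n. ?X n)"
        by (intro SUP_emeasure_incseq) auto
      then show ?thesis unfolding un by (simp add: emeasure_density)
    qed
    show ?thesis unfolding sup[OF assms(1)] sup[OF assms(2)]
    proof (intro SUP_mono' le)
      fix n :: nat
      have "1 / (real n + 2) < 1" by simp
      moreover have "0 < 1 / (real n + 2)" by simp
      ultimately show "1 - 1 / (real n + 2) \<in> {0<..<1}" by (intro greaterThanLessThan_iff[THEN iffD2] conjI; linarith)
    qed
  qed
  \<comment> \<open>The superlevel sets of w are initial segments of (0,1), up to the right end point.\<close>
  have level: "(\<integral>\<^sup>+s\<in>J y. B s \<partial>lborel) \<le> (\<integral>\<^sup>+s\<in>J y. A s \<partial>lborel)" for y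
  proof (cases "J y = {}")
    case False
    have J01: "J y \<subseteq> {0<..<1}" by (auto simp: J_def W_def indicator_def split: if_splits)
    define c where "c = Sup (J y)"
    have bdd: "bdd_above (J y)" using J01 by (auto intro!: bdd_aboveI[of _ 1])
    have "c \<le> 1" unfolding c_def using J01 False by (intro cSup_least) auto
    have up: "s \<le> c" if "s \<in> J y" for s unfolding c_def using that bdd by (rule cSup_upper)
    have "0 < c" using False up J01 by fastforce
    have down: "s \<in> J y" if s: "0 < s" "s < c" for s
    proof -
      obtain r where r: "r \<in> J y" "s < r" using s False bdd unfolding c_def by (auto simp: less_cSup_iff)
      then have "w r \<le> w s" using s J01 by (auto intro!: monotone_onD[OF w])
      moreover have "r \<in> {0<..<1}" "s \<in> {0<..<1}" using r s J01 \<open>c \<le> 1\<close> by auto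
      ultimately show ?thesis using r by (simp add: J_def W_def)
    qed
    have eq: "(\<integral>\<^sup>+s\<in>J y. F s \<partial>lborel) = (\<integral>\<^sup>+s\<in>{0<..<c}. F s \<partial>lborel)" for F
    proof (rule nn_integral_cong_AE)
      show "AE s in lborel. F s * indicator (J y) s = F s * indicator {0<..<c} s"
        using AE_lborel_singleton[of c]
      proof eventually_elim
        case (elim s)
        then have "s \<in> J y \<longleftrightarrow> s \<in> {0<..<c}" using up[of s] down[of s] J01 by auto
        then show ?case by (simp add: indicator_def)
      qed
    qed
    show ?thesis unfolding eq using le[of c] full \<open>0 < c\<close> \<open>c \<le> 1\<close> by (cases "c = 1") auto
  qed simp
  have layer: "(\<integral>\<^sup>+s\<in>{0<..<1}. F s * ennreal (w s) \<partial>lborel) = (\<integral>\<^sup>+y. (\<integral>\<^sup>+s\<in>J y. F s \<partial>lborel) \<partial>lborel)"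
    if [measurable]: "F \<in> borel_measurable borel" for F :: "real \<Rightarrow> ennreal"
  proof -
    have "(\<integral>\<^sup>+s\<in>{0<..<1}. F s * ennreal (w s) \<partial>lborel) = (\<integral>\<^sup>+s. F s * ennreal (W s) \<partial>lborel)"
      by (auto intro!: nn_integral_cong simp: W_def indicator_def)
    also have "\<dots> = (\<integral>\<^sup>+s. F s * (\<integral>\<^sup>+y. indicator {0..<W s} y \<partial>lborel) \<partial>lborel)"
    proof (intro nn_integral_cong arg_cong2[where f = "(*)"] refl)
      \<comment> \<open>For negative \<open>W s\<close> the interval is empty and
        \<open>ennreal\<close> truncates to 0.\<close>
      fix s show "ennreal (W s) = (\<integral>\<^sup>+y. indicator {0..<W s} y \<partial>lborel)"
        by (cases "0 \<le> W s") (auto simp: ennreal_neg)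
    qed
    also have "\<dots> = (\<integral>\<^sup>+s. \<integral>\<^sup>+y. F s * indicator (J y) s \<partial>lborel \<partial>lborel)"
      by (subst nn_integral_cmult[symmetric]) (auto intro!: nn_integral_cong simp: J_def indicator_def)
    also have "\<dots> = (\<integral>\<^sup>+y. (\<integral>\<^sup>+s\<in>J y. F s \<partial>lborel) \<partial>lborel)"
    proof (rule lborel_pair.Fubini')
      show "(\<lambda>(y, s). F s * indicator (J y) s) \<in> borel_measurable (lborel \<Otimes>\<^sub>M lborel)"
        unfolding J_def indicator_def by measurable
    qed
    finally show ?thesis .
  qed
  show ?thesis
    unfolding layer[OF assms(1)] layer[OF assms(2)] by (intro nn_integral_mono level)
qed

subsection \<open>The SSD-minimal quantile function\<close>

text \<open>The deterministic core: two quantile functions and the explicit formula. Integrability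
  is asked only up to t < 1, which is all that the weighted hypothesis on \<open>Q1\<close>
  yields.\<close>

locale quantile_pair =
  fixes Q1 Q2 Qs :: "real \<Rightarrow> real"
  assumes Q1: "Q1 \<in> quantile_functions" and Q2: "Q2 \<in> quantile_functions"
    and Q1_integrable: "\<And>t. t < 1 \<Longrightarrow> set_integrable lborel {0<..<t} Q1"
    and Q2_integrable: "\<And>t. t < 1 \<Longrightarrow> set_integrable lborel {0<..<t} Q2"
    and Qs: "\<And>t. t \<in> {0<..<1} \<Longrightarrow>
      Qs t = Q1 t * of_bool (max_gap Q1 Q2 t > gap Q1 Q2 t) + max (Q1 t) (Q2 t) * of_bool (max_gap Q1 Q2 t = gap Q1 Q2 t)"
begin

section \<open>The gap and its running maximum\<close>

abbreviation "f \<equiv> gap Q1 Q2"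
abbreviation "\<phi> \<equiv> max_gap Q1 Q2"
abbreviation "g \<equiv> \<lambda>t. Q2 t - Q1 t"

lemma g_integrable_on: "0 \<le> a \<Longrightarrow> b < 1 \<Longrightarrow> g integrable_on {a..b}"
proof -
  assume "0 \<le> a" "b < 1"
  then have "set_integrable lborel {0<..<b} g"
    by (intro set_integral_diff Q1_integrable Q2_integrable)
  from set_integrable_Ioo_integral(1)[OF this] show ?thesis
    using \<open>0 \<le> a\<close> by (auto elim: integrable_on_subinterval)
qed

lemma gap_eq_integral: "t < 1 \<Longrightarrow> f t = integral {0..t} g"
  unfolding gap_def
  by (intro set_integrable_Ioo_integral(2) set_integral_diff Q1_integrable Q2_integrable)

lemma gap_diff:
  assumes "0 \<le> t" "t \<le> u" "u < 1"
  shows "f u - f t = integral {t..u} g"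
  using Henstock_Kurzweil_Integration.integral_combine[OF assms(1,2) g_integrable_on[of 0 u]] assms
  by (simp add: gap_eq_integral)

lemma continuous_on_gap: "b < 1 \<Longrightarrow> continuous_on {0..b} f"
  using indefinite_integral_continuous_1[OF g_integrable_on[of 0 b]]
  by (rule continuous_on_eq) (auto simp: gap_eq_integral)

lemma bdd_above_gap: "b < 1 \<Longrightarrow> bdd_above (f ` {0..b})"
  by (intro bounded_imp_bdd_above compact_imp_bounded compact_continuous_image continuous_on_gap) auto

lemma gap_le_max_gap: "0 \<le> s \<Longrightarrow> s \<le> t \<Longrightarrow> t < 1 \<Longrightarrow> f s \<le> \<phi> t"
  unfolding max_gap_def by (intro cSUP_upper bdd_above_gap) auto

lemma max_gap_least: "0 \<le> t \<Longrightarrow> (\<And>s. 0 \<le> s \<Longrightarrow> s \<le> t \<Longrightarrow> f s \<le> c) \<Longrightarrow> \<phi> t \<le> c"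
  unfolding max_gap_def by (intro cSUP_least) auto

lemma max_gap_mono: "0 \<le> s \<Longrightarrow> s \<le> t \<Longrightarrow> t < 1 \<Longrightarrow> \<phi> s \<le> \<phi> t"
  by (intro max_gap_least gap_le_max_gap) auto

text \<open>The running maximum up to u is the larger of that up to t and the maximum over [t,u].
  Upper bounds on the growth of \<open>\<phi>\<close> are obtained in this way.\<close>

lemma max_gap_extend:
  assumes "0 \<le> t" "t \<le> u" "u < 1" "\<phi> t \<le> c" "\<And>s. t \<le> s \<Longrightarrow> s \<le> u \<Longrightarrow> f s \<le> c"
  shows "\<phi> u \<le> c"
proof (rule max_gap_least)
  fix s assume s: "0 \<le> s" "s \<le> u"
  show "f s \<le> c"
  proof (cases "s \<le> t")
    case True
    then have "f s \<le> \<phi> t" using s assms by (intro gap_le_max_gap) auto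
    then show ?thesis using assms by simp
  qed (use s assms in auto)
qed (use assms in auto)

lemma max_gap_0: "\<phi> 0 = 0"
  by (simp add: gap_eq_integral max_gap_def)

text \<open>A running maximum inherits the modulus of continuity: \<open>\<phi>\<close> grows over
  [t,u] by at most the largest increment of \<open>f\<close> from t. Half of e leaves room for the
  non-strict bound on the supremum.\<close>

lemma continuous_on_max_gap:
  assumes "b < 1"
  shows "continuous_on {0..b} \<phi>"
proof (rule uniformly_continuous_imp_continuous, unfold uniformly_continuous_on_def, intro allI impI)
  fix e :: real assume "e > 0"
  have "uniformly_continuous_on {0..b} f"
    using assms by (intro compact_uniformly_continuous continuous_on_gap) auto
  then obtain d where d: "d > 0" "\<And>s t. s \<in> {0..b} \<Longrightarrow> t \<in> {0..b} \<Longrightarrow> dist s t < d \<Longrightarrow> dist (f s) (f t) < e / 2"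
    unfolding uniformly_continuous_on_def using \<open>e > 0\<close> by (metis half_gt_zero)
  have close: "\<bar>\<phi> u - \<phi> t\<bar> < e" if "0 \<le> t" "t \<le> u" "u \<le> b" "u - t < d" for t u
  proof -
    have "\<phi> u \<le> \<phi> t + e / 2"
    proof (rule max_gap_extend)
      fix s assume "t \<le> s" "s \<le> u"
      then have "dist (f s) (f t) < e / 2" using that by (intro d) (auto simp: dist_real_def)
      moreover have "f t \<le> \<phi> t" using that assms by (intro gap_le_max_gap) auto
      ultimately show "f s \<le> \<phi> t + e / 2"
        unfolding dist_real_def using \<open>e > 0\<close> by linarith
    qed (use that assms \<open>e > 0\<close> in auto)
    moreover have "\<phi> t \<le> \<phi> u" using that assms by (intro max_gap_mono) auto
    ultimately show ?thesis using \<open>e > 0\<close> by simp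
  qed
  show "\<exists>d>0. \<forall>x\<in>{0..b}. \<forall>x'\<in>{0..b}. dist x' x < d \<longrightarrow> dist (\<phi> x') (\<phi> x) < e"
  proof (intro exI[of _ d] conjI d(1) ballI impI)
    fix x x' assume "x \<in> {0..b}" "x' \<in> {0..b}" "dist x' x < d"
    then show "dist (\<phi> x') (\<phi> x) < e"
      using close[of x x'] close[of x' x] by (cases "x \<le> x'") (auto simp: dist_real_def)
  qed
qed

text \<open>Once \<open>f\<close> touches its running maximum, it keeps touching it while it
  increases.\<close>

lemma max_gap_eq_gap_mono:
  assumes "0 \<le> s" "s \<le> t" "t < 1" "\<phi> s = f s" "\<And>r. s \<le> r \<Longrightarrow> r \<le> t \<Longrightarrow> 0 \<le> g r"
  shows "\<phi> t = f t"
proof (rule antisym)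
  have inc: "f r \<le> f t" if "s \<le> r" "r \<le> t" for r
  proof -
    have "0 \<le> integral {r..t} g"
      using that assms by (intro Henstock_Kurzweil_Integration.integral_nonneg g_integrable_on) auto
    then show ?thesis using gap_diff[of r t] that assms by simp
  qed
  show "\<phi> t \<le> f t" using assms inc by (intro max_gap_extend[of s t "f t"]) auto
  show "f t \<le> \<phi> t" using assms by (intro gap_le_max_gap) auto
qed

section \<open>The excess of \<open>Qs\<close> over \<open>Q1\<close>\<close>

definition h :: "real \<Rightarrow> real" where "h = (\<lambda>t. Qs t - Q1 t)"

text \<open>As \<open>f t \<le> \<phi> t\<close>, exactly one of the two indicators in the formula
  for \<open>Qs\<close> is 1.\<close>

lemma h_eq: "t \<in> {0<..<1} \<Longrightarrow> h t = (if \<phi> t = f t then max 0 (g t) else 0)"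
  using gap_le_max_gap[of t t] by (auto simp: h_def Qs)

lemma h_nonneg: "t \<in> {0<..<1} \<Longrightarrow> 0 \<le> h t"
  by (simp add: h_eq)

text \<open>The danger is a fall from \<open>Q2 s\<close> at a contact point s to a smaller
  \<open>Q1 t\<close>. But \<open>Q1 t < Q2 s\<close> forces \<open>Q1 \<le> Q2\<close> on all of
  [s,t], so contact persists up to t and \<open>Qs t\<close> is at least \<open>Q2 t\<close>. In the
  other case \<open>Qs s\<close> is at most \<open>Q1 t\<close>.\<close>

lemma mono_on_Qs: "mono_on {0<..<1} Qs"
proof (rule mono_onI)
  fix s t :: real assume st: "s \<in> {0<..<1}" "t \<in> {0<..<1}" "s \<le> t"
  have Q1st: "Q1 s \<le> Q1 t" using st by (intro quantile_functions_mono[OF Q1]) auto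
  show "Qs s \<le> Qs t"
  proof (cases "\<phi> s = f s \<and> Q1 t < Q2 s")
    case True
    have "0 \<le> g r" if "s \<le> r" "r \<le> t" for r
      using quantile_functions_mono[OF Q1, of r t] quantile_functions_mono[OF Q2, of s r] True that st
      by auto
    then have "\<phi> t = f t" using st True by (intro max_gap_eq_gap_mono[of s t]) auto
    then show ?thesis
      using True Q1st quantile_functions_mono[OF Q2, of s t] st by (auto simp: Qs)
  next
    case False
    then have "Qs s \<le> Q1 t" using Q1st h_eq[OF st(1)] by (auto simp: h_def split: if_splits)
    also have "Q1 t \<le> Qs t" using h_nonneg[OF st(2)] by (simp add: h_def)
    finally show ?thesis .
  qed
qed

lemma Qs_integrable: "t < 1 \<Longrightarrow> set_integrable lborel {0<..<t} Qs"
  using h_nonneg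
  by (intro mono_on_set_integrable_above[OF mono_on_Qs _ Q1_integrable]) (auto simp: h_def)

lemma h_integrable_on: "0 \<le> a \<Longrightarrow> b < 1 \<Longrightarrow> h integrable_on {a..b}"
proof -
  assume "0 \<le> a" "b < 1"
  then have "set_integrable lborel {0<..<b} h"
    unfolding h_def by (intro set_integral_diff Q1_integrable Qs_integrable)
  from set_integrable_Ioo_integral(1)[OF this] show ?thesis
    using \<open>0 \<le> a\<close> by (auto elim: integrable_on_subinterval)
qed

text \<open>The right derivative of \<open>\<phi>\<close> is \<open>h\<close>, and \<open>h\<close> is right-continuous: when \<open>\<phi> t > f t\<close> or \<open>g t < 0\<close>,
  both are constant to the right of \<open>t\<close>; when \<open>\<phi> t = f t\<close> and \<open>g t > 0\<close>, they agree there with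
  \<open>f\<close> and \<open>g\<close>; when \<open>g t = 0\<close>, both increments are squeezed by those of \<open>g\<close>.\<close>

lemma max_gap_right_derivative:
  assumes t: "0 < t" "t < 1" and "e > 0"
  obtains b where "t < b" "b < 1"
    "\<And>u. t < u \<Longrightarrow> u < b \<Longrightarrow> \<bar>h u - h t\<bar> \<le> e"
    "\<And>u. t < u \<Longrightarrow> u < b \<Longrightarrow> \<bar>\<phi> u - \<phi> t - integral {t..u} h\<bar> \<le> e * (u - t)"
proof -
  note result = that
  \<comment> \<open>Shrinks a right neighbourhood so that it stays inside (0,1).\<close>
  have right: "\<exists>b>t. b < 1 \<and> (\<forall>u. t < u \<longrightarrow> u < b \<longrightarrow> P u)" if ev: "\<forall>\<^sub>F u in at_right t. P u" for P
  proof -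
    obtain b where "b > t" "\<And>u. t < u \<Longrightarrow> u < b \<Longrightarrow> P u"
      using ev t by (auto simp: eventually_at_right[of t 1])
    then show ?thesis using t by (intro exI[of _ "min b ((t + 1) / 2)"]) (auto simp: min_less_iff_disj)
  qed
  have flim: "(f \<longlongrightarrow> f t) (at_right t)"
  proof -
    obtain c where c: "t < c" "c < 1" using t dense by blast
    then have "continuous_on {t..c} f" using continuous_on_gap[of c] t by (auto intro: continuous_on_subset)
    then show ?thesis using c by (simp add: continuous_on_Icc_at_rightD)
  qed
  have glim: "(g \<longlongrightarrow> g t) (at_right t)"
    using t by (intro tendsto_diff quantile_functions_right_tendsto Q1 Q2)
  have const_max: "\<phi> u = \<phi> t" if "t < u" "u < 1" "\<And>s. t \<le> s \<Longrightarrow> s \<le> u \<Longrightarrow> f s \<le> \<phi> t" for u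
  proof (rule antisym)
    show "\<phi> u \<le> \<phi> t" using that t by (intro max_gap_extend[of t u "\<phi> t"]) auto
    show "\<phi> t \<le> \<phi> u" using that t by (intro max_gap_mono) auto
  qed
  \<comment> \<open>Shared end of the two cases in which \<open>\<phi>\<close> is constant to the
    right of t.\<close>
  have done_zero: thesis
    if b: "t < b" "b < 1" and h0: "\<And>u. t \<le> u \<Longrightarrow> u < b \<Longrightarrow> h u = 0" and "\<And>u. t < u \<Longrightarrow> u < b \<Longrightarrow> \<phi> u = \<phi> t" for b
  proof (rule result[OF b])
    fix u assume u: "t < u" "u < b"
    show "\<bar>h u - h t\<bar> \<le> e" using h0[of u] h0[of t] u \<open>e > 0\<close> by simp
    have "integral {t..u} h = integral {t..u} (\<lambda>_. 0)"
      using h0 u by (intro Henstock_Kurzweil_Integration.integral_cong) auto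
    then show "\<bar>\<phi> u - \<phi> t - integral {t..u} h\<bar> \<le> e * (u - t)"
      using u that \<open>e > 0\<close> by simp
  qed
  have f_le: "f t \<le> \<phi> t" using t by (intro gap_le_max_gap) auto
  consider (above) "\<phi> t > f t" | (neg) "\<phi> t = f t" "g t < 0" | (pos) "\<phi> t = f t" "g t > 0"
    | (zero) "\<phi> t = f t" "g t = 0" using f_le by linarith
  then show thesis
  proof cases
    case above
    have "\<forall>\<^sub>F u in at_right t. f u < \<phi> t" using flim above by (rule order_tendstoD)
    then obtain b where b: "t < b" "b < 1" "\<And>u. t < u \<Longrightarrow> u < b \<Longrightarrow> f u < \<phi> t"
      using right[of "\<lambda>u. f u < \<phi> t"] by blast
    have less: "f u < \<phi> t" if "t \<le> u" "u < b" for u using b that above by (cases "u = t") auto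
    have max_eq: "\<phi> u = \<phi> t" if "t < u" "u < b" for u
      using that b by (intro const_max less_imp_le[OF less]) auto
    have "h u = 0" if "t \<le> u" "u < b" for u
      using that t b(1,2) less[of u] max_eq[of u] by (cases "u = t") (auto simp: h_eq)
    then show thesis using done_zero b max_eq by blast
  next
    case neg
    have "\<forall>\<^sub>F u in at_right t. g u < 0" using glim neg(2) by (rule order_tendstoD)
    then obtain b where b: "t < b" "b < 1" "\<And>u. t < u \<Longrightarrow> u < b \<Longrightarrow> g u < 0"
      using right[of "\<lambda>u. g u < 0"] by blast
    have less: "g u < 0" if "t \<le> u" "u < b" for u using b that neg by (cases "u = t") auto
    have dec: "f u \<le> \<phi> t" if "t \<le> u" "u < b" for u
    proof -
      have "integral {t..u} g \<le> integral {t..u} (\<lambda>_. 0)"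
        using that t b less by (intro integral_le g_integrable_on) (auto intro!: less_imp_le)
      then show ?thesis using gap_diff[of t u] that t b neg by simp
    qed
    have "\<phi> u = \<phi> t" if "t < u" "u < b" for u using that b by (intro const_max dec) auto
    moreover have "h u = 0" if "t \<le> u" "u < b" for u
      using that t b less[of u] by (auto simp: h_eq)
    ultimately show thesis using done_zero b by blast
  next
    case pos
    have "\<forall>\<^sub>F u in at_right t. g u > 0" using glim pos(2) by (rule order_tendstoD)
    moreover have "\<forall>\<^sub>F u in at_right t. dist (g u) (g t) < e" using glim \<open>e > 0\<close> by (rule tendstoD)
    ultimately have "\<forall>\<^sub>F u in at_right t. g u > 0 \<and> dist (g u) (g t) < e" by eventually_elim auto
    then obtain b where b: "t < b" "b < 1" "\<And>u. t < u \<Longrightarrow> u < b \<Longrightarrow> g u > 0 \<and> dist (g u) (g t) < e"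
      using right[of "\<lambda>u. g u > 0 \<and> dist (g u) (g t) < e"] by blast
    have gpos: "g u > 0" if "t \<le> u" "u < b" for u using b(3)[of u] that pos by (cases "u = t") auto
    have max_eq: "\<phi> u = f u" if "t \<le> u" "u < b" for u
      using that t b pos gpos by (intro max_gap_eq_gap_mono[of t u]) (auto intro!: less_imp_le)
    have h: "h u = g u" if "t \<le> u" "u < b" for u
      using that t b max_eq[OF that] gpos[OF that] by (simp add: h_eq)
    show thesis
    proof (rule result[OF b(1,2)])
      fix u assume u: "t < u" "u < b"
      show "\<bar>h u - h t\<bar> \<le> e" using h[of u] h[of t] u b(3)[OF u] by (simp add: dist_real_def)
      have "integral {t..u} h = integral {t..u} g"
        using h u by (intro Henstock_Kurzweil_Integration.integral_cong) auto
      then show "\<bar>\<phi> u - \<phi> t - integral {t..u} h\<bar> \<le> e * (u - t)"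
        using gap_diff[of t u] max_eq[of u] max_eq[of t] u t b \<open>e > 0\<close> by simp
    qed
  next
    \<comment> \<open>Contact may be lost and regained arbitrarily close to t, so \<open>h\<close>
      need be neither \<open>g\<close> nor 0 nearby; only the bounds 0 and e are available.\<close>
    case zero
    have "\<forall>\<^sub>F u in at_right t. dist (g u) (g t) < e" using glim \<open>e > 0\<close> by (rule tendstoD)
    then obtain b where b: "t < b" "b < 1" "\<And>u. t < u \<Longrightarrow> u < b \<Longrightarrow> dist (g u) (g t) < e"
      using right[of "\<lambda>u. dist (g u) (g t) < e"] by blast
    have g_le: "g u \<le> e" if "t \<le> u" "u < b" for u
      using b(3)[of u] that zero \<open>e > 0\<close> by (cases "u = t") (auto simp: dist_real_def)
    have h01: "0 \<le> h u" "h u \<le> e" if "t \<le> u" "u < b" for u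
      using g_le[OF that] that t b \<open>e > 0\<close> by (auto simp: h_eq)
    show thesis
    proof (rule result[OF b(1,2)])
      fix u assume u: "t < u" "u < b"
      show "\<bar>h u - h t\<bar> \<le> e" using h01[of u] u zero t by (simp add: h_eq[of t])
      have int_le: "integral {t..s} k \<le> e * (s - t)"
        if "t \<le> s" "s \<le> u" "k integrable_on {t..s}" "\<And>r. t \<le> r \<Longrightarrow> r < b \<Longrightarrow> k r \<le> e" for k s
        using integral_le[OF that(3) integrable_const_ivl, of e] that u by (simp add: mult.commute)
      have "\<phi> u \<le> \<phi> t + e * (u - t)"
      proof (rule max_gap_extend)
        fix s assume s: "t \<le> s" "s \<le> u"
        then have "f s - f t \<le> e * (s - t)"
          using gap_diff[of t s] t b u by (auto intro!: int_le g_integrable_on g_le)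
        also have "\<dots> \<le> e * (u - t)" using s \<open>e > 0\<close> by simp
        finally show "f s \<le> \<phi> t + e * (u - t)" using zero by simp
      qed (use t b u \<open>e > 0\<close> in auto)
      moreover have "\<phi> t \<le> \<phi> u" using t b u by (intro max_gap_mono) auto
      moreover have "0 \<le> integral {t..u} h"
        using t b u h01 by (intro Henstock_Kurzweil_Integration.integral_nonneg h_integrable_on) auto
      moreover have "integral {t..u} h \<le> e * (u - t)"
        using t b u by (intro int_le h_integrable_on h01) auto
      ultimately show "\<bar>\<phi> u - \<phi> t - integral {t..u} h\<bar> \<le> e * (u - t)" by linarith
    qed
  qed
qed

lemma Qs_in_quantile_functions: "Qs \<in> quantile_functions"
proof -
  have "(Qs \<longlongrightarrow> Qs t) (at_right t)" if t: "0 < t" "t < 1" for t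
  proof -
    have "(h \<longlongrightarrow> h t) (at_right t)"
    proof (rule tendstoI)
      fix e :: real assume "e > 0"
      then obtain b where b: "t < b" "b < 1"
        "\<And>u. t < u \<Longrightarrow> u < b \<Longrightarrow> \<bar>h u - h t\<bar> \<le> e / 2"
        "\<And>u. t < u \<Longrightarrow> u < b \<Longrightarrow> \<bar>\<phi> u - \<phi> t - integral {t..u} h\<bar> \<le> e / 2 * (u - t)"
        by (rule max_gap_right_derivative[OF t half_gt_zero]) blast
      show "\<forall>\<^sub>F u in at_right t. dist (h u) (h t) < e"
        using eventually_at_right_real[OF b(1)]
      proof eventually_elim
        case (elim u)
        then have "\<bar>h u - h t\<bar> \<le> e / 2" by (intro b(3)) auto
        then show ?case unfolding dist_real_def using \<open>e > 0\<close> by linarith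
      qed
    qed
    from tendsto_add[OF quantile_functions_right_tendsto[OF Q1 t] this]
    show ?thesis by (simp add: h_def)
  qed
  then show ?thesis
    using mono_on_Qs by (auto simp: quantile_functions_def continuous_within)
qed

text \<open>The difference of both sides is continuous, vanishes at 0 and has right derivative 0.
  The estimate used is already stated against the integral of \<open>h\<close> over [t,u], not
  against \<open>h t * (u - t)\<close>, so it is directly a bound on an increment of
  \<open>D\<close>.\<close>

lemma integral_h_eq_max_gap:
  assumes b: "b \<in> {0<..<1}"
  shows "integral {0..b} h = \<phi> b"
proof -
  define D where "D = (\<lambda>t. \<phi> t - integral {0..t} h)"
  have "D b = D 0"
  proof (rule right_derivative_zero_imp_eq[where D = D and a = 0 and b = b])
    show "continuous_on {0..b} D"
      unfolding D_def using b
      by (intro continuous_on_diff continuous_on_max_gap indefinite_integral_continuous_1 h_integrable_on) auto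
  next
    fix t e :: real assume t: "0 < t" "t < b" and e: "0 < e"
    have "t < 1" using t b by simp
    then obtain c where c: "t < c" "c < 1"
      "\<And>u. t < u \<Longrightarrow> u < c \<Longrightarrow> \<bar>h u - h t\<bar> \<le> e"
      "\<And>u. t < u \<Longrightarrow> u < c \<Longrightarrow> \<bar>\<phi> u - \<phi> t - integral {t..u} h\<bar> \<le> e * (u - t)"
      by (rule max_gap_right_derivative[OF t(1) _ e]) blast
    have "\<bar>D u - D t\<bar> \<le> e * (u - t)" if "t < u" "u < c" for u
      using c(4)[OF that] Henstock_Kurzweil_Integration.integral_combine[of 0 t u h] h_integrable_on[of 0 u] that t c
      by (simp add: D_def algebra_simps)
    then show "\<forall>\<^sub>F u in at_right t. \<bar>D u - D t\<bar> \<le> e * (u - t)"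
      using eventually_at_right_real[OF c(1)] by (auto elim!: eventually_mono)
  qed (use b in auto)
  then show ?thesis by (simp add: D_def max_gap_0)
qed

section \<open>Feasible functions and SSD-minimality\<close>

lemma feasible_integrable:
  assumes "Q \<in> fsd_set Q1" "t < 1"
  shows "set_integrable lborel {0<..<t} Q"
  using assms
  by (intro mono_on_set_integrable_above[OF _ _ Q1_integrable])
    (auto simp: fsd_set_def fsd_ge_def quantile_functions_mono_on)

lemma ssd_ge_iff:
  assumes "\<And>t. t < 1 \<Longrightarrow> set_integrable lborel {0<..<t} Q" "\<And>t. t < 1 \<Longrightarrow> set_integrable lborel {0<..<t} Q'"
  shows "ssd_ge Q Q' \<longleftrightarrow> (\<forall>t\<in>{0<..<1}. integral {0..t} Q' \<le> integral {0..t} Q)"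
  unfolding ssd_ge_def
  by (intro ball_cong refl)
    (simp add: ext_integral_eq_integral[OF assms(1)] ext_integral_eq_integral[OF assms(2)]
      set_integrable_Ioo_integral(2)[OF assms(1)] set_integrable_Ioo_integral(2)[OF assms(2)])

lemma integral_Qs:
  assumes "t \<in> {0<..<1}"
  shows "integral {0..t} Qs = integral {0..t} Q1 + \<phi> t"
proof -
  have "integral {0..t} h = integral {0..t} Qs - integral {0..t} Q1"
    unfolding h_def using assms
    by (intro Henstock_Kurzweil_Integration.integral_diff set_integrable_Ioo_integral Qs_integrable Q1_integrable) auto
  then show ?thesis using integral_h_eq_max_gap[OF assms] by simp
qed

lemma gap_eq_diff: "t < 1 \<Longrightarrow> f t = integral {0..t} Q2 - integral {0..t} Q1"
  unfolding gap_eq_integral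
  by (intro Henstock_Kurzweil_Integration.integral_diff set_integrable_Ioo_integral Q1_integrable Q2_integrable)

text \<open>The SSD constraint is \<open>f \<le> \<phi>\<close> after adding the integral of
  \<open>Q1\<close> to both sides; the FSD constraint is \<open>0 \<le> h\<close>.\<close>

lemma Qs_feasible: "Qs \<in> fsd_set Q1 \<inter> ssd_set Q2"
proof -
  have "integral {0..t} Q2 \<le> integral {0..t} Qs" if "t \<in> {0<..<1}" for t
    using integral_Qs[OF that] gap_eq_diff[of t] gap_le_max_gap[of t t] that by simp
  then have "ssd_ge Qs Q2" by (simp add: ssd_ge_iff Qs_integrable Q2_integrable)
  moreover have "fsd_ge Qs Q1" using h_nonneg by (auto simp: fsd_ge_def h_def)
  ultimately show ?thesis using Qs_in_quantile_functions by (simp add: fsd_set_def ssd_set_def)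
qed

lemma integral_Qs_le:
  assumes Q: "Q \<in> fsd_set Q1 \<inter> ssd_set Q2" and t: "t \<in> {0<..<1}"
  shows "integral {0..t} Qs \<le> integral {0..t} Q"
proof -
  have ge: "integral {0..s} Q2 \<le> integral {0..s} Q" if "0 \<le> s" "s < 1" for s
  \<comment> \<open>\<open>ssd_ge\<close> does not speak about 0, but the supremum defining
    \<open>\<phi>\<close> includes it; there both integrals are 0.\<close>
  proof (cases "s = 0")
    case False
    then show ?thesis
      using Q that feasible_integrable[of Q] Q2_integrable
      by (auto simp: ssd_set_def ssd_ge_iff)
  qed simp
  have int: "Q integrable_on {0..t}" "Q1 integrable_on {0..t}"
    using feasible_integrable[of Q t] Q1_integrable[of t] Q t by (auto intro: set_integrable_Ioo_integral)
  have "\<phi> t \<le> integral {0..t} Q - integral {0..t} Q1"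
  proof (rule max_gap_least)
    fix s assume s: "0 \<le> s" "s \<le> t"
    \<comment> \<open>The open interval avoids s = 0, where \<open>fsd_ge\<close> gives
      nothing.\<close>
    have "integral {s<..<t} Q1 \<le> integral {s<..<t} Q"
    proof (rule integral_le)
      show "Q1 integrable_on {s<..<t}" "Q integrable_on {s<..<t}"
        using int s by (auto simp: integrable_on_open_interval_real elim: integrable_on_subinterval)
    qed (use Q s t in \<open>auto simp: fsd_set_def fsd_ge_def\<close>)
    then have "integral {s..t} Q1 \<le> integral {s..t} Q" by (simp add: integral_open_interval_real)
    then show "f s \<le> integral {0..t} Q - integral {0..t} Q1"
      using ge[of s] gap_eq_diff[of s] s t
        Henstock_Kurzweil_Integration.integral_combine[OF s int(1)]
        Henstock_Kurzweil_Integration.integral_combine[OF s int(2)] by simp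
  qed (use t in auto)
  then show ?thesis using integral_Qs[OF t] by simp
qed

lemma ssd_minimal_Qs: "ssd_minimal (fsd_set Q1 \<inter> ssd_set Q2) Qs"
  unfolding ssd_minimal_def
proof (intro conjI ballI Qs_feasible)
  fix Q assume Q: "Q \<in> fsd_set Q1 \<inter> ssd_set Q2"
  then have "ssd_ge Q Qs"
    using feasible_integrable Qs_integrable integral_Qs_le by (subst ssd_ge_iff) auto
  then show "Q \<in> ssd_set Qs" using Q by (auto simp: ssd_set_def)
qed

text \<open>Two minimal elements dominate each other, so their integrals over every (0,t)
  agree.\<close>

lemma ssd_minimal_unique:
  assumes "ssd_minimal (fsd_set Q1 \<inter> ssd_set Q2) Q" "t \<in> {0<..<1}"
  shows "Q t = Qs t"
proof (rule quantile_functions_eq_if_integrals_eq[OF _ Qs_in_quantile_functions _ _ _ assms(2)])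
  have Q: "Q \<in> fsd_set Q1 \<inter> ssd_set Q2" and "Qs \<in> ssd_set Q"
    using assms Qs_feasible by (auto simp: ssd_minimal_def)
  then show "Q \<in> quantile_functions" by (simp add: fsd_set_def)
  fix s :: real assume s: "s \<in> {0<..<1}"
  show "Q integrable_on {0..s}" "Qs integrable_on {0..s}"
    using feasible_integrable[of Q s] Qs_integrable[of s] Q s by (auto intro: set_integrable_Ioo_integral)
  have "integral {0..s} Q \<le> integral {0..s} Qs"
    using \<open>Qs \<in> ssd_set Q\<close> Q s feasible_integrable Qs_integrable
    by (auto simp: ssd_set_def ssd_ge_iff)
  then show "integral {0..s} Q = integral {0..s} Qs"
    using integral_Qs_le[OF Q s] by simp
qed

end

subsection \<open>Weighted integrals\<close>

lemma set_integrable_if_nn_integral_finite: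
  fixes k :: "real \<Rightarrow> real"
  assumes "set_borel_measurable borel S k" "(\<integral>\<^sup>+s\<in>S. ennreal \<bar>k s\<bar> \<partial>lborel) < \<infinity>"
  shows "set_integrable lborel S k"
  unfolding set_integrable_def
proof (rule integrableI_bounded)
  show "(\<lambda>s. indicator S s *\<^sub>R k s) \<in> borel_measurable lborel"
    using assms(1) by (simp add: set_borel_measurable_def)
  have "(\<integral>\<^sup>+s. ennreal (norm (indicator S s *\<^sub>R k s)) \<partial>lborel) = (\<integral>\<^sup>+s\<in>S. ennreal \<bar>k s\<bar> \<partial>lborel)"
    by (intro nn_integral_cong) (auto simp: indicator_def)
  then show "(\<integral>\<^sup>+s. ennreal (norm (indicator S s *\<^sub>R k s)) \<partial>lborel) < \<infinity>"
    using assms(2) by simp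
qed

lemma set_nn_integral_eq_integral:
  fixes k :: "real \<Rightarrow> real"
  assumes "set_integrable lborel S k" "\<And>s. s \<in> S \<Longrightarrow> 0 \<le> k s"
  shows "(\<integral>\<^sup>+s\<in>S. ennreal (k s) \<partial>lborel) = ennreal (LINT s:S|lborel. k s)"
proof -
  have "(\<integral>\<^sup>+s\<in>S. ennreal (k s) \<partial>lborel) = (\<integral>\<^sup>+s. ennreal (indicator S s *\<^sub>R k s) \<partial>lborel)"
    by (intro nn_integral_cong) (auto simp: indicator_def)
  also have "\<dots> = ennreal (LINT s:S|lborel. k s)"
    unfolding set_lebesgue_integral_def using assms
    by (intro nn_integral_eq_integral) (auto simp: set_integrable_def indicator_def)
  finally show ?thesis .
qed

lemma (in quantile_pair) weighted_integral_Qs_le: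
  assumes w: "antimono_on {0<..<1} w" and w_nonneg: "\<And>s. s \<in> {0<..<1} \<Longrightarrow> 0 \<le> w s"
    and Q: "Q \<in> fsd_set Q1 \<inter> ssd_set Q2"
    and int1: "set_integrable lborel {0<..<1} (\<lambda>s. Q1 s * w s)"
    and intQs: "set_integrable lborel {0<..<1} (\<lambda>s. Qs s * w s)"
    and intQ: "set_integrable lborel {0<..<1} (\<lambda>s. Q s * w s)"
  shows "(LINT s:{0<..<1}|lborel. Qs s * w s) \<le> (LINT s:{0<..<1}|lborel. Q s * w s)"
proof -
  \<comment> \<open>The excess over \<open>Q1\<close>, cut off outside (0,1), where the functions
    are arbitrary and possibly not measurable.\<close>
  define A where "A = (\<lambda>F s. ennreal (indicator {0<..<1} s *\<^sub>R F s - indicator {0<..<1} s *\<^sub>R Q1 s))"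
  have meas: "A F \<in> borel_measurable borel" if "F \<in> fsd_set Q1" for F
    using mono_on_set_borel_measurable[of F "{0<..<1}"] mono_on_set_borel_measurable[of Q1 "{0<..<1}"] that Q1
    unfolding A_def
    by (intro measurable_compose[OF _ measurable_ennreal] borel_measurable_diff)
      (auto simp: set_borel_measurable_def fsd_set_def quantile_functions_mono_on)
  have ge: "Q1 s \<le> F s" if "F \<in> fsd_set Q1" "s \<in> {0<..<1}" for F s
    using that by (auto simp: fsd_set_def fsd_ge_def)
  have part: "(\<integral>\<^sup>+s\<in>{0<..<t}. A F s \<partial>lborel) = ennreal (integral {0..t} F - integral {0..t} Q1)"
    if F: "F \<in> fsd_set Q1" and t: "t \<in> {0<..<1}" for F t
  proof -
    have int: "set_integrable lborel {0<..<t} F" "set_integrable lborel {0<..<t} Q1"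
      using feasible_integrable[OF F] Q1_integrable t by auto
    have "(\<integral>\<^sup>+s\<in>{0<..<t}. A F s \<partial>lborel) = (\<integral>\<^sup>+s\<in>{0<..<t}. ennreal (F s - Q1 s) \<partial>lborel)"
      using t by (intro nn_integral_cong) (auto simp: A_def indicator_def)
    also have "\<dots> = ennreal (LINT s:{0<..<t}|lborel. F s - Q1 s)"
      using int ge[OF F] t by (intro set_nn_integral_eq_integral set_integral_diff) auto
    also have "(LINT s:{0<..<t}|lborel. F s - Q1 s) = integral {0..t} F - integral {0..t} Q1"
      using int by (simp add: set_integral_diff set_integrable_Ioo_integral(2))
    finally show ?thesis .
  qed
  have total: "(\<integral>\<^sup>+s\<in>{0<..<1}. A F s * ennreal (w s) \<partial>lborel)
      = ennreal ((LINT s:{0<..<1}|lborel. F s * w s) - (LINT s:{0<..<1}|lborel. Q1 s * w s))"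
    and total_nonneg: "0 \<le> (LINT s:{0<..<1}|lborel. F s * w s) - (LINT s:{0<..<1}|lborel. Q1 s * w s)"
    if F: "F \<in> fsd_set Q1" and int: "set_integrable lborel {0<..<1} (\<lambda>s. F s * w s)" for F
  proof -
    have nonneg: "0 \<le> F s * w s - Q1 s * w s" if "s \<in> {0<..<1}" for s
      using ge[OF F that] w_nonneg[OF that] by (simp add: mult_right_mono)
    have diff: "(LINT s:{0<..<1}|lborel. F s * w s - Q1 s * w s)
        = (LINT s:{0<..<1}|lborel. F s * w s) - (LINT s:{0<..<1}|lborel. Q1 s * w s)"
      using int int1 by (simp add: set_integral_diff)
    have "(\<integral>\<^sup>+s\<in>{0<..<1}. A F s * ennreal (w s) \<partial>lborel)
        = (\<integral>\<^sup>+s\<in>{0<..<1}. ennreal (F s * w s - Q1 s * w s) \<partial>lborel)"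
      using ge[OF F] w_nonneg
      by (intro nn_integral_cong) (auto simp: A_def indicator_def left_diff_distrib simp flip: ennreal_mult)
    also have "\<dots> = ennreal (LINT s:{0<..<1}|lborel. F s * w s - Q1 s * w s)"
      using int int1 nonneg by (intro set_nn_integral_eq_integral set_integral_diff) auto
    finally show "(\<integral>\<^sup>+s\<in>{0<..<1}. A F s * ennreal (w s) \<partial>lborel)
      = ennreal ((LINT s:{0<..<1}|lborel. F s * w s) - (LINT s:{0<..<1}|lborel. Q1 s * w s))"
      unfolding diff .
    show "0 \<le> (LINT s:{0<..<1}|lborel. F s * w s) - (LINT s:{0<..<1}|lborel. Q1 s * w s)"
      unfolding diff[symmetric] using nonneg
      by (auto simp: set_lebesgue_integral_def indicator_def intro!: Bochner_Integration.integral_nonneg)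
  qed
  have fsd: "Q \<in> fsd_set Q1" "Qs \<in> fsd_set Q1" using Q Qs_feasible by auto
  have "(\<integral>\<^sup>+s\<in>{0<..<1}. A Qs s * ennreal (w s) \<partial>lborel) \<le> (\<integral>\<^sup>+s\<in>{0<..<1}. A Q s * ennreal (w s) \<partial>lborel)"
    using fsd integral_Qs_le[OF Q]
    by (intro nn_integral_mult_antimono_on_le w meas) (auto simp: part intro!: ennreal_leI)
  \<comment> \<open>The excess of \<open>Q\<close> has a non-negative weighted integral, so the
    inequality in \<open>ennreal\<close> is one between reals, and the integral of \<open>Q1\<close>
    cancels.\<close>
  then show ?thesis
    using total_nonneg[OF fsd(1) intQ] by (simp add: total fsd intQs intQ ennreal_le_iff)
qed

text \<open>The first two conjuncts justify speaking of the SSD-minimal function and identify it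
  with the formula; agreement is claimed on (0,1) only, as values elsewhere carry no
  meaning.\<close>

theorem mainTheorem2:
  fixes M :: "'a measure" and \<rho> X1 X2 :: "'a \<Rightarrow> real" and Qs :: "real \<Rightarrow> real"
  defines "Q\<rho> \<equiv> upper_quantile M \<rho>"
    and "Q1 \<equiv> upper_quantile M X1"
    and "Q2 \<equiv> upper_quantile M X2"
  defines "f \<equiv> gap Q1 Q2" and "\<phi> \<equiv> max_gap Q1 Q2"
  assumes "prob_space M" and "complete_measure M" and "non_atomic M"
    and "\<rho> \<in> borel_measurable M"
    and "measure M {\<omega> \<in> space M. \<rho> \<omega> > 0} = 1"
    and "(\<integral>\<^sup>+\<omega>. ennreal (\<rho> \<omega>) \<partial>M) < \<infinity>"
    and "X1 \<in> borel_measurable M"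
    and "integrable M X2"
    and "(\<integral>\<^sup>+s\<in>{0<..<1}. ennreal \<bar>Q2 s\<bar> \<partial>lborel) < \<infinity>"
    and "(\<integral>\<^sup>+s\<in>{0<..<1}. ennreal (\<bar>Q1 s\<bar> * Q\<rho> (1 - s)) \<partial>lborel) < \<infinity>"
    and "(\<integral>\<^sup>+s\<in>{0<..<1}. ennreal (\<bar>Q2 s\<bar> * Q\<rho> (1 - s)) \<partial>lborel) < \<infinity>"
    and "\<And>t. t \<in> {0<..<1} \<Longrightarrow>
           Qs t = Q1 t * of_bool (\<phi> t > f t) + max (Q1 t) (Q2 t) * of_bool (\<phi> t = f t)"
  shows "ssd_minimal (fsd_set Q1 \<inter> ssd_set Q2) Qs \<and>
         (\<forall>Q. ssd_minimal (fsd_set Q1 \<inter> ssd_set Q2) Q \<longrightarrow> (\<forall>t\<in>{0<..<1}. Q t = Qs t)) \<and>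
         is_arg_min (cost Q\<rho>) (\<lambda>Q. Q \<in> quantiles_rho Q\<rho> \<and> Q \<in> fsd_set Q1 \<inter> ssd_set Q2) Qs"
proof -
  interpret prob_space M by fact
  have q: "Q\<rho> \<in> quantile_functions" "Q1 \<in> quantile_functions" "Q2 \<in> quantile_functions"
    unfolding Q\<rho>_def Q1_def Q2_def
    using assms by (auto intro!: upper_quantile_in_quantile_functions)
  define w where "w = (\<lambda>s. Q\<rho> (1 - s))"
  have w: "antimono_on {0<..<1} w"
    unfolding w_def by (intro monotone_onI quantile_functions_mono[OF q(1)]) auto
  have w_pos: "0 < w s" if "s \<in> {0<..<1}" for s
    unfolding w_def Q\<rho>_def using that assms by (intro upper_quantile_pos) auto
  have w_abs: "\<bar>w s\<bar> = w s" if "s \<in> {0<..<1}" for s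
    using w_pos[OF that] by simp
  have w_meas: "set_borel_measurable borel {0<..<1} (\<lambda>s. - w s)"
    using w by (intro mono_on_set_borel_measurable) (auto simp: monotone_on_def)
  have meas: "set_borel_measurable borel {0<..<1} (\<lambda>s. F s * w s)"
    if F: "set_borel_measurable borel {0<..<1} F" for F
  proof -
    \<comment> \<open>Measurability is known for the non-decreasing negated weight; the outer minus
      sign restores the sign.\<close>
    have "(\<lambda>s. - ((indicator {0<..<1} s *\<^sub>R F s) * (indicator {0<..<1} s *\<^sub>R - w s))) \<in> borel_measurable borel"
      using F w_meas unfolding set_borel_measurable_def
      by (intro borel_measurable_uminus borel_measurable_times)
    also have "(\<lambda>s. - ((indicator {0<..<1} s *\<^sub>R F s) * (indicator {0<..<1} s *\<^sub>R - w s)))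
        = (\<lambda>s. indicator {0<..<1} s *\<^sub>R (F s * w s))"
      by (auto simp: indicator_def)
    finally show ?thesis unfolding set_borel_measurable_def .
  qed
  have q_meas: "set_borel_measurable borel {0<..<1} F" if "F \<in> quantile_functions" for F
    using that by (intro mono_on_set_borel_measurable quantile_functions_mono_on) auto
  have weighted_int: "set_integrable lborel {0<..<1} (\<lambda>s. F s * w s)"
    if "set_borel_measurable borel {0<..<1} F" "(\<integral>\<^sup>+s\<in>{0<..<1}. ennreal (\<bar>F s\<bar> * Q\<rho> (1 - s)) \<partial>lborel) < \<infinity>" for F
  proof (rule set_integrable_if_nn_integral_finite[OF meas[OF that(1)]])
    have "(\<integral>\<^sup>+s\<in>{0<..<1}. ennreal \<bar>F s * w s\<bar> \<partial>lborel) = (\<integral>\<^sup>+s\<in>{0<..<1}. ennreal (\<bar>F s\<bar> * Q\<rho> (1 - s)) \<partial>lborel)"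
      using w_abs by (intro nn_integral_cong) (auto simp: indicator_def abs_mult w_def)
    then show "(\<integral>\<^sup>+s\<in>{0<..<1}. ennreal \<bar>F s * w s\<bar> \<partial>lborel) < \<infinity>" using that(2) by simp
  qed
  have int1: "set_integrable lborel {0<..<1} (\<lambda>s. Q1 s * w s)"
    and int2: "set_integrable lborel {0<..<1} (\<lambda>s. Q2 s * w s)"
    using assms q by (auto intro: weighted_int q_meas)
  \<comment> \<open>On (0,t) the weight is bounded below by the positive number w t.\<close>
  have local_int: "set_integrable lborel {0<..<t} F"
    if F: "F \<in> quantile_functions" and int: "set_integrable lborel {0<..<1} (\<lambda>s. F s * w s)" and "t < 1" for F t
  proof (cases "0 < t")
    case True
    then have t: "t \<in> {0<..<1}" using \<open>t < 1\<close> by simp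
    show ?thesis
    proof (rule set_integrable_bound)
      show "set_integrable lborel {0<..<t} (\<lambda>s. (F s * w s) / w t)"
        using set_integrable_subset[OF int, of "{0<..<t}"] \<open>t < 1\<close>
        by (simp add: subset_eq)
      show "set_borel_measurable lborel {0<..<t} F"
        using mono_on_set_borel_measurable[OF quantile_functions_mono_on[OF F], of "{0<..<t}"] \<open>t < 1\<close>
        by (simp add: set_borel_measurable_def subset_eq)
      have "\<bar>F s\<bar> \<le> \<bar>F s * w s / w t\<bar>" if s: "s \<in> {0<..<t}" for s
      proof -
        have "w t \<le> w s" using s t by (intro monotone_onD[OF w]) auto
        then have "\<bar>F s\<bar> * w t \<le> \<bar>F s\<bar> * w s" by (intro mult_left_mono) auto
        then show ?thesis using w_pos[OF t] w_abs[of s] s t by (simp add: abs_mult field_simps)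
      qed
      then show "AE s in lborel. s \<in> {0<..<t} \<longrightarrow> norm (F s) \<le> norm (F s * w s / w t)" by auto
    qed
  qed (simp add: set_integrable_def)
  interpret P: quantile_pair Q1 Q2 Qs
    using q local_int int1 int2 assms by unfold_locales (auto simp: f_def \<phi>_def)
  have Qs_q: "Qs \<in> quantile_functions" by (rule P.Qs_in_quantile_functions)
  have intQs: "set_integrable lborel {0<..<1} (\<lambda>s. Qs s * w s)"
  proof (rule set_integrable_bound)
    show "set_integrable lborel {0<..<1} (\<lambda>s. \<bar>Q1 s * w s\<bar> + \<bar>Q2 s * w s\<bar>)"
      using int1 int2 by (intro set_integral_add set_integrable_abs)
    show "set_borel_measurable lborel {0<..<1} (\<lambda>s. Qs s * w s)"
      using meas[OF q_meas[OF Qs_q]] by (simp add: set_borel_measurable_def)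
    have "\<bar>Qs s * w s\<bar> \<le> \<bar>Q1 s * w s\<bar> + \<bar>Q2 s * w s\<bar>" if s: "s \<in> {0<..<1}" for s
    proof -
      have "\<bar>Qs s\<bar> \<le> \<bar>Q1 s\<bar> + \<bar>Q2 s\<bar>" using P.Qs[OF s] by auto
      then have "\<bar>Qs s\<bar> * \<bar>w s\<bar> \<le> (\<bar>Q1 s\<bar> + \<bar>Q2 s\<bar>) * \<bar>w s\<bar>" by (intro mult_right_mono) auto
      then show ?thesis by (simp add: abs_mult distrib_right)
    qed
    then show "AE s in lborel. s \<in> {0<..<1} \<longrightarrow> norm (Qs s * w s) \<le> norm (\<bar>Q1 s * w s\<bar> + \<bar>Q2 s * w s\<bar>)"
      by auto
  qed
  have Qs_rho: "Qs \<in> quantiles_rho Q\<rho>"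
  proof -
    have "(\<integral>\<^sup>+s\<in>{0<..<1}. ennreal (max (Qs s) 0 * Q\<rho> (1 - s)) \<partial>lborel)
        \<le> (\<integral>\<^sup>+s. ennreal (norm (indicator {0<..<1} s *\<^sub>R (Qs s * w s))) \<partial>lborel)"
      using w_pos[THEN less_imp_le]
      by (intro nn_integral_mono) (auto simp: indicator_def w_def abs_mult intro!: ennreal_leI mult_mono)
    also have "\<dots> < \<infinity>" using intQs unfolding set_integrable_def integrable_iff_bounded by blast
    finally show ?thesis using Qs_q by (simp add: quantiles_rho_def)
  qed
  have "cost Q\<rho> Qs \<le> cost Q\<rho> Q"
    if Q: "Q \<in> quantiles_rho Q\<rho>" and feas: "Q \<in> fsd_set Q1 \<inter> ssd_set Q2" for Q
  proof -
    have Q_q: "Q \<in> quantile_functions" using Q by (simp add: quantiles_rho_def)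
    have "set_borel_measurable borel {0<..<1} (\<lambda>s. max (Q s) 0)"
    proof -
      have "(\<lambda>s. max (indicator {0<..<1} s *\<^sub>R Q s) 0) \<in> borel_measurable borel"
        using q_meas[OF Q_q] unfolding set_borel_measurable_def by (intro borel_measurable_max) auto
      also have "(\<lambda>s. max (indicator {0<..<1} s *\<^sub>R Q s) 0) = (\<lambda>s. indicator {0<..<1} s *\<^sub>R max (Q s) 0)"
        by (auto simp: indicator_def)
      finally show ?thesis unfolding set_borel_measurable_def .
    qed
    then have pos: "set_integrable lborel {0<..<1} (\<lambda>s. max (Q s) 0 * w s)"
      using Q by (intro weighted_int) (auto simp: quantiles_rho_def)
    \<comment> \<open>\<open>Q1\<close> controls the negative part of \<open>Q\<close> and
      membership in \<open>quantiles_rho\<close> the positive part, so the cost is a real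
      number.\<close>
    have intQ: "set_integrable lborel {0<..<1} (\<lambda>s. Q s * w s)"
    proof (rule set_integrable_bound)
      show "set_integrable lborel {0<..<1} (\<lambda>s. \<bar>Q1 s * w s\<bar> + \<bar>max (Q s) 0 * w s\<bar>)"
        using int1 pos by (intro set_integral_add set_integrable_abs)
      show "set_borel_measurable lborel {0<..<1} (\<lambda>s. Q s * w s)"
        using meas[OF q_meas[OF Q_q]] by (simp add: set_borel_measurable_def)
      have "\<bar>Q s * w s\<bar> \<le> \<bar>Q1 s * w s\<bar> + \<bar>max (Q s) 0 * w s\<bar>" if s: "s \<in> {0<..<1}" for s
      proof -
        have "Q1 s \<le> Q s" using feas s by (auto simp: fsd_set_def fsd_ge_def)
        then have "\<bar>Q s\<bar> * \<bar>w s\<bar> \<le> (\<bar>Q1 s\<bar> + \<bar>max (Q s) 0\<bar>) * \<bar>w s\<bar>" by (intro mult_right_mono) auto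
        then show ?thesis by (simp add: abs_mult distrib_right)
      qed
      then show "AE s in lborel. s \<in> {0<..<1} \<longrightarrow> norm (Q s * w s) \<le> norm (\<bar>Q1 s * w s\<bar> + \<bar>max (Q s) 0 * w s\<bar>)"
        by auto
    qed
    have "(LINT s:{0<..<1}|lborel. Qs s * w s) \<le> (LINT s:{0<..<1}|lborel. Q s * w s)"
      using w_pos by (intro P.weighted_integral_Qs_le w feas int1 intQs intQ) (auto intro: less_imp_le)
    then show ?thesis
      unfolding cost_def using intQs intQ by (simp add: ext_integral_eq_integral w_def)
  qed
  then have "is_arg_min (cost Q\<rho>) (\<lambda>Q. Q \<in> quantiles_rho Q\<rho> \<and> Q \<in> fsd_set Q1 \<inter> ssd_set Q2) Qs"
    using Qs_rho P.Qs_feasible by (auto simp: is_arg_min_def not_less)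
  then show ?thesis using P.ssd_minimal_Qs P.ssd_minimal_unique by blast
qed

end
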